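(* Let $\mu\ge1$ and $\eta>0$. For integers $N\ge2$ with $N^{1/\mu}>\eta$, consider the discrete-time $(\mu,(\eta^j),N)$-random walk $\{\xi_n\}$ on $\Omega_N$ started at $0$, and let $Z_n^*=\max_{1\le m\le n}|\xi_m|$. (1) For fixed such $N$, $\lim_{j\to\infty}\mathbb P_0\big[Z^*_{\lfloor N^{j/\mu}\rfloor}\le j\big]$ equals $0$ iff $\eta>1$, equals $1/e$ iff $\eta=1$, and equals $1$ iff $\eta<1$. (2) For each fixed $j\ge1$, $$\lim_{N\to\infty}\mathbb P_0\big[Z^*_{\lfloor N^{j/\mu}\rfloor}=\ell\big]=\begin{cases}e^{-\eta^j},&\ell=j,\\ 1-e^{-\eta^j},&\ell=j+1.\end{cases}$$
   Context: $\Omega_N=\{x=(x_1,x_2,\dots): x_i\in\mathbb Z_N,\ x_i\ne0 \text{ for only finitely many } i\}$ with $\mathbb Z_N$ the cyclic group of order $N$ and componentwise addition mod $N$; $|x|=\max\{i:x_i\ne0\}$ for $x\neq 0$ and $|0|=0$. Given a probability distribution $(r_j)_{j\ge1}$ on $\{1,2,\dots\}$ with all $r_j>0$, the discrete-time $r_j$-random walk is a sum $\xi_n$ of $n$ i.i.d. steps in $\Omega_N$ with $\mathbb P[\text{step}=y]=\frac{r_{|y|}}{N^{|y|-1}(N-1)}$ for $y\neq0$ and $\mathbb P[\text{step}=0]=0$. The $(\mu,(\eta^j),N)$-random walk is the $r_j$-random walk with $r_j=D\,\eta^{j-1}N^{-(j-1)/\mu}$, $j\ge1$, $D$ being the normalizing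 constant. $\mathbb P_0$ is the law of the walk started at $0$. *)

theory Defs
  imports "HOL-Probability.Probability" "HOL-Algebra.Product_Groups" "HOL-Algebra.Elementary_Groups"
begin

text \<open>
  The hierarchical group is the direct sum of countably many copies of the cyclic group of
  order \<open>N\<close>, with coordinates indexed by \<open>1, 2, \<dots>\<close>. Library convention: elements are functions
  on \<open>nat\<close> that take the value \<open>undefined\<close> at the index 0, which lies outside the index set.
\<close>

definition hier_group :: "nat \<Rightarrow> (nat \<Rightarrow> int) monoid" where
  "hier_group N = sum_group {1..} (\<lambda>_. integer_mod_group N)"

definition hier_norm :: "(nat \<Rightarrow> int) \<Rightarrow> nat" where
  "hier_norm x = (if \<forall>i\<ge>1. x i = 0 then 0 else Max {i. i \<ge> 1 \<and> x i \<noteq> 0})"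

definition hier_step_prob :: "nat \<Rightarrow> (nat \<Rightarrow> real) \<Rightarrow> (nat \<Rightarrow> int) \<Rightarrow> real" where
  "hier_step_prob N r y =
     (if y = \<one>\<^bsub>hier_group N\<^esub> then 0
      else r (hier_norm y) / (real N ^ (hier_norm y - 1) * (real N - 1)))"

text \<open>
  All measures live on the countable carrier, not on the uncountable type \<open>nat \<Rightarrow> int\<close>, so
  that the walk is measurable with respect to the product of the discrete sigma algebras.
\<close>

definition hier_step :: "nat \<Rightarrow> (nat \<Rightarrow> real) \<Rightarrow> (nat \<Rightarrow> int) measure" where
  "hier_step N r =
     point_measure (carrier (hier_group N)) (\<lambda>y. ennreal (hier_step_prob N r y))"

fun hier_walk :: "nat \<Rightarrow> (nat \<Rightarrow> nat \<Rightarrow> int) \<Rightarrow> nat \<Rightarrow> (nat \<Rightarrow> int)" where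
  "hier_walk N X 0 = \<one>\<^bsub>hier_group N\<^esub>"
| "hier_walk N X (Suc n) = hier_walk N X n \<otimes>\<^bsub>hier_group N\<^esub> X n"

text \<open>The law, on path space, of the walk started at 0 with i.i.d. steps.\<close>

definition hier_walk_law :: "nat \<Rightarrow> (nat \<Rightarrow> real) \<Rightarrow> (nat \<Rightarrow> nat \<Rightarrow> int) measure" where
  "hier_walk_law N r =
     distr (PiM UNIV (\<lambda>_. hier_step N r))
           (PiM UNIV (\<lambda>_. count_space (carrier (hier_group N)))) (hier_walk N)"

text \<open>The value at \<open>j\<close> is meaningful for \<open>j \<ge> 1\<close>; the normalization sums over \<open>j = Suc k\<close>.\<close>

definition eta_weight :: "real \<Rightarrow> real \<Rightarrow> nat \<Rightarrow> nat \<Rightarrow> real" where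
  "eta_weight \<mu> \<eta> N j = \<eta> ^ (j - 1) * real N powr (- (real (j - 1) / \<mu>))"

definition eta_rate :: "real \<Rightarrow> real \<Rightarrow> nat \<Rightarrow> nat \<Rightarrow> real" where
  "eta_rate \<mu> \<eta> N j = eta_weight \<mu> \<eta> N j / (\<Sum>k. eta_weight \<mu> \<eta> N (Suc k))"

definition eta_walk_prob :: "real \<Rightarrow> real \<Rightarrow> nat \<Rightarrow> ((nat \<Rightarrow> nat \<Rightarrow> int) \<Rightarrow> bool) \<Rightarrow> real" where
  "eta_walk_prob \<mu> \<eta> N E =
     measure (hier_walk_law N (eta_rate \<mu> \<eta> N))
       {\<xi> \<in> space (hier_walk_law N (eta_rate \<mu> \<eta> N)). E \<xi>}"

text \<open>The running maximum \<open>Z\<^sup>*\<^sub>n\<close> of a path (for \<open>n \<ge> 1\<close>).\<close>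

definition max_norm :: "(nat \<Rightarrow> nat \<Rightarrow> int) \<Rightarrow> nat \<Rightarrow> nat" where
  "max_norm \<xi> n = Max ((\<lambda>m. hier_norm (\<xi> m)) ` {1..n})"

subsection \<open>The definitions yield probability measures\<close>

lemma carrier_hier_group:
  assumes "N \<ge> 2"
  shows "carrier (hier_group N) = {x \<in> {1..} \<rightarrow>\<^sub>E {0..<int N}. finite {i. i \<ge> 1 \<and> x i \<noteq> 0}}"
  using assms by (simp add: hier_group_def carrier_sum_group carrier_integer_mod_group)

lemma one_hier_group: "\<one>\<^bsub>hier_group N\<^esub> = (\<lambda>i\<in>{1..}. 0)"
  by (simp add: hier_group_def)

lemma group_hier_group: "group (hier_group N)"
  by (simp add: hier_group_def)

lemma hier_norm_le_iff:
  assumes "N \<ge> 2" "x \<in> carrier (hier_group N)"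
  shows "hier_norm x \<le> j \<longleftrightarrow> (\<forall>i>j. x i = 0)"
proof (cases "\<forall>i\<ge>1. x i = 0")
  case True
  then show ?thesis by (auto simp: hier_norm_def)
next
  case False
  have fin: "finite {i. i \<ge> 1 \<and> x i \<noteq> 0}"
    using assms by (simp add: carrier_hier_group)
  have "{i. i \<ge> 1 \<and> x i \<noteq> 0} \<noteq> {}" using False by auto
  then have "Max {i. i \<ge> 1 \<and> x i \<noteq> 0} \<le> j \<longleftrightarrow> (\<forall>i\<in>{i. i \<ge> 1 \<and> x i \<noteq> 0}. i \<le> j)"
    by (rule Max_le_iff[OF fin])
  then have "hier_norm x \<le> j \<longleftrightarrow> (\<forall>i\<in>{i. i \<ge> 1 \<and> x i \<noteq> 0}. i \<le> j)"
    unfolding hier_norm_def if_not_P[OF False] .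
  then show ?thesis
    by (metis (mono_tags, lifting) False One_nat_def Suc_leI gr_implies_not0
        mem_Collect_eq not_le not_gr_zero)
qed

lemma card_hier_ball:
  assumes "N \<ge> 2"
  shows "finite {x \<in> carrier (hier_group N). hier_norm x \<le> j}"
    and "card {x \<in> carrier (hier_group N). hier_norm x \<le> j} = N ^ j"
proof -
  let ?B = "{x \<in> carrier (hier_group N). hier_norm x \<le> j}"
  let ?P = "{1..j} \<rightarrow>\<^sub>E {0..<int N}"
  have bij: "bij_betw (\<lambda>x. restrict x {1..j}) ?B ?P"
  proof (rule bij_betwI[where g = "\<lambda>y. \<lambda>i\<in>{1..}. if i \<le> j then y i else 0"])
    show "(\<lambda>x. restrict x {1..j}) \<in> ?B \<rightarrow> ?P"
      using assms by (auto simp: carrier_hier_group PiE_iff)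
    show "(\<lambda>y. \<lambda>i\<in>{1..}. if i \<le> j then y i else 0) \<in> ?P \<rightarrow> ?B"
    proof
      fix y assume y: "y \<in> ?P"
      let ?x = "\<lambda>i\<in>{1..}. if i \<le> j then y i else (0::int)"
      have "finite {i. i \<ge> 1 \<and> ?x i \<noteq> 0}"
        by (rule finite_subset[of _ "{..j}"]) auto
      then have "?x \<in> carrier (hier_group N)"
        using y assms by (auto simp: carrier_hier_group PiE_iff)
      then show "?x \<in> ?B" using assms by (auto simp: hier_norm_le_iff)
    qed
    show "(\<lambda>i\<in>{1..}. if i \<le> j then restrict x {1..j} i else 0) = x" if "x \<in> ?B" for x
    proof
      fix i
      show "(\<lambda>i\<in>{1..}. if i \<le> j then restrict x {1..j} i else 0) i = x i"
        using that assms hier_norm_le_iff[of N x j]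
        by (auto simp: carrier_hier_group PiE_iff extensional_def)
    qed
    show "restrict (\<lambda>i\<in>{1..}. if i \<le> j then y i else 0) {1..j} = y" if "y \<in> ?P" for y
      using that by (auto simp: PiE_iff extensional_def fun_eq_iff)
  qed
  have "finite ?P" by (intro finite_PiE) auto
  then show "finite ?B" using bij_betw_finite[OF bij] by simp
  show "card ?B = N ^ j"
    using bij_betw_same_card[OF bij] by (simp add: card_PiE)
qed

lemma card_hier_sphere:
  assumes "N \<ge> 2"
  shows "finite {x \<in> carrier (hier_group N). hier_norm x = Suc j}"
    and "real (card {x \<in> carrier (hier_group N). hier_norm x = Suc j}) = real N ^ j * (real N - 1)"
proof -
  let ?B = "\<lambda>j. {x \<in> carrier (hier_group N). hier_norm x \<le> j}"
  have eq: "{x \<in> carrier (hier_group N). hier_norm x = Suc j} = ?B (Suc j) - ?B j"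
    by auto
  show "finite {x \<in> carrier (hier_group N). hier_norm x = Suc j}"
    unfolding eq using card_hier_ball(1)[OF assms] by blast
  have "card (?B (Suc j) - ?B j) = N ^ Suc j - N ^ j"
    using card_hier_ball[OF assms] by (subst card_Diff_subset) auto
  moreover have "N ^ j \<le> N ^ Suc j" using assms by simp
  ultimately show "real (card {x \<in> carrier (hier_group N). hier_norm x = Suc j})
      = real N ^ j * (real N - 1)"
    unfolding eq by (simp add: of_nat_diff algebra_simps)
qed

lemma countable_carrier_hier_group:
  assumes "N \<ge> 2"
  shows "countable (carrier (hier_group N))"
proof -
  have "carrier (hier_group N) = (\<Union>j. {x \<in> carrier (hier_group N). hier_norm x \<le> j})"
    by auto
  also have "countable \<dots>"
    using card_hier_ball(1)[OF assms] by (intro countable_UN) (auto intro: countable_finite)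
  finally show ?thesis .
qed

lemma hier_norm_eq_0_iff:
  assumes "N \<ge> 2" "x \<in> carrier (hier_group N)"
  shows "hier_norm x = 0 \<longleftrightarrow> x = \<one>\<^bsub>hier_group N\<^esub>"
proof -
  have "hier_norm x = 0 \<longleftrightarrow> (\<forall>i>0. x i = 0)"
    using hier_norm_le_iff[OF assms, of 0] by simp
  also have "\<dots> \<longleftrightarrow> x = \<one>\<^bsub>hier_group N\<^esub>"
    using assms by (auto simp: one_hier_group carrier_hier_group PiE_iff extensional_def fun_eq_iff)
  finally show ?thesis .
qed

lemma prob_space_hier_step:
  assumes "N \<ge> 2" and "\<And>j. r j \<ge> 0" and "(\<lambda>k. r (Suc k)) sums 1"
  shows "prob_space (hier_step N r)"
proof
  let ?S = "\<lambda>j. {x \<in> carrier (hier_group N). hier_norm x = j}"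
  let ?M = "hier_step N r"
  have sets: "sets ?M = Pow (carrier (hier_group N))"
    by (simp add: hier_step_def sets_point_measure)
  have one: "\<one>\<^bsub>hier_group N\<^esub> \<in> carrier (hier_group N)"
    by (rule monoid.one_closed[OF group.is_monoid[OF group_hier_group]])
  have S0: "?S 0 = {\<one>\<^bsub>hier_group N\<^esub>}"
  proof (rule Set.set_eqI)
    fix x
    show "x \<in> ?S 0 \<longleftrightarrow> x \<in> {\<one>\<^bsub>hier_group N\<^esub>}"
      using hier_norm_eq_0_iff[OF assms(1), of x] one
      unfolding mem_Collect_eq singleton_iff by metis
  qed
  have e0: "emeasure ?M (?S 0) = 0"
    unfolding hier_step_def S0 using one
    by (subst emeasure_point_measure_finite2) (simp_all add: hier_step_prob_def del: one_sum_group)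
  have e: "emeasure ?M (?S (Suc k)) = ennreal (r (Suc k))" for k
  proof -
    have "emeasure ?M (?S (Suc k)) = (\<Sum>y\<in>?S (Suc k). ennreal (hier_step_prob N r y))"
      unfolding hier_step_def using card_hier_sphere(1)[OF assms(1)]
      by (subst emeasure_point_measure_finite2) auto
    also have "\<dots> = (\<Sum>y\<in>?S (Suc k). ennreal (r (Suc k) / (real N ^ k * (real N - 1))))"
    proof (rule sum.cong[OF refl])
      fix y assume y: "y \<in> ?S (Suc k)"
      then have n: "hier_norm y = Suc k" and c: "y \<in> carrier (hier_group N)" by simp_all
      have "y \<noteq> \<one>\<^bsub>hier_group N\<^esub>"
        unfolding hier_norm_eq_0_iff[OF assms(1) c, symmetric] n by (rule nat.distinct)
      then show "ennreal (hier_step_prob N r y) = ennreal (r (Suc k) / (real N ^ k * (real N - 1)))"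
        unfolding hier_step_prob_def by (simp only: n if_False diff_Suc_1)
    qed
    also have "\<dots> = of_nat (card (?S (Suc k))) * ennreal (r (Suc k) / (real N ^ k * (real N - 1)))"
      by (rule sum_constant)
    also have "\<dots> = ennreal (real (card (?S (Suc k))) * (r (Suc k) / (real N ^ k * (real N - 1))))"
      unfolding ennreal_of_nat_eq_real_of_nat
      by (rule ennreal_mult'[OF of_nat_0_le_iff, symmetric])
    also have "\<dots> = ennreal (r (Suc k))"
      using assms(1) by (simp only: card_hier_sphere(2)[OF assms(1)]) simp
    finally show ?thesis .
  qed
  have "emeasure ?M (space ?M) = emeasure ?M (\<Union>j. ?S j)"
    by (rule arg_cong[where f = "emeasure ?M"]) (auto simp: hier_step_def space_point_measure)
  also have "\<dots> = (\<Sum>j. emeasure ?M (?S j))"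
    by (intro suminf_emeasure[symmetric]) (auto simp: sets disjoint_family_on_def)
  also have "\<dots> = (\<Sum>k. emeasure ?M (?S (Suc k)))"
    using suminf_offset[of "\<lambda>j. emeasure ?M (?S j)" 1, OF summableI]
    unfolding One_nat_def sum.lessThan_Suc lessThan_0 sum.empty e0 add_0 add_Suc_right add_0_right .
  also have "\<dots> = 1"
    unfolding e by (subst suminf_ennreal_eq[OF assms(2,3)]) (rule ennreal_1)
  finally show "emeasure ?M (space ?M) = 1" .
qed

lemma eta_rate_sums:
  assumes "\<mu> \<ge> 1" "\<eta> > 0" "N \<ge> 2" "real N powr (1 / \<mu>) > \<eta>"
  shows "eta_rate \<mu> \<eta> N j > 0" and "(\<lambda>k. eta_rate \<mu> \<eta> N (Suc k)) sums 1"
proof -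
  define q where "q = \<eta> / real N powr (1 / \<mu>)"
  have q: "0 < q" "q < 1" using assms by (auto simp: q_def)
  have w: "eta_weight \<mu> \<eta> N (Suc k) = q ^ k" for k
  proof -
    have N: "real N > 0" using assms by simp
    have "(real N powr (1 / \<mu>)) ^ k = (real N powr (1 / \<mu>)) powr real k"
      using N by (intro powr_realpow[symmetric]) simp
    also have "\<dots> = real N powr (real k / \<mu>)"
      by (simp only: powr_powr) simp
    finally have "q ^ k = \<eta> ^ k / real N powr (real k / \<mu>)"
      unfolding q_def power_divide by (rule arg_cong)
    also have "\<dots> = eta_weight \<mu> \<eta> N (Suc k)"
      unfolding eta_weight_def diff_Suc_1 powr_minus divide_inverse ..
    finally show ?thesis ..
  qed
  have s: "(\<lambda>k. q ^ k) sums (1 / (1 - q))" using q by (intro geometric_sums) auto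
  then have S: "(\<Sum>k. eta_weight \<mu> \<eta> N (Suc k)) = 1 / (1 - q)"
    by (simp add: w sums_iff)
  show "eta_rate \<mu> \<eta> N j > 0"
    unfolding eta_rate_def S unfolding eta_weight_def using q assms by simp
  show "(\<lambda>k. eta_rate \<mu> \<eta> N (Suc k)) sums 1"
    using sums_divide[OF s, of "1 / (1 - q)"] q unfolding eta_rate_def S unfolding w by simp
qed

lemma measurable_hier_walk:
  assumes "N \<ge> 2"
  shows "hier_walk N \<in> PiM UNIV (\<lambda>_. hier_step N r) \<rightarrow>\<^sub>M
           PiM UNIV (\<lambda>_. count_space (carrier (hier_group N)))"
proof -
  let ?C = "carrier (hier_group N)"
  have c: "countable ?C" by (rule countable_carrier_hier_group[OF assms])
  have X: "(\<lambda>X. X n) \<in> PiM UNIV (\<lambda>_. hier_step N r) \<rightarrow>\<^sub>M count_space ?C" for n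
  proof -
    have "(\<lambda>X. X n) \<in> PiM UNIV (\<lambda>_. hier_step N r) \<rightarrow>\<^sub>M hier_step N r"
      by (rule measurable_component_singleton) simp
    also have "PiM UNIV (\<lambda>_. hier_step N r) \<rightarrow>\<^sub>M hier_step N r
        = PiM UNIV (\<lambda>_. hier_step N r) \<rightarrow>\<^sub>M count_space ?C"
      by (rule measurable_cong_sets) (simp_all add: hier_step_def sets_point_measure)
    finally show ?thesis .
  qed
  have "(\<lambda>X. hier_walk N X n) \<in> PiM UNIV (\<lambda>_. hier_step N r) \<rightarrow>\<^sub>M count_space ?C" for n
  proof (induction n)
    case 0
    then show ?case
      using group.is_monoid[OF group_hier_group, of N] by (simp add: monoid.one_closed)
  next
    case (Suc n)
    have "(\<lambda>(x, y). x \<otimes>\<^bsub>hier_group N\<^esub> y) \<in> count_space (?C \<times> ?C) \<rightarrow>\<^sub>M count_space ?C"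
      using group.is_monoid[OF group_hier_group, of N] by (auto simp: monoid.m_closed)
    then have m: "(\<lambda>(x, y). x \<otimes>\<^bsub>hier_group N\<^esub> y)
        \<in> count_space ?C \<Otimes>\<^sub>M count_space ?C \<rightarrow>\<^sub>M count_space ?C"
      by (simp add: pair_measure_countable[OF c c])
    have "(\<lambda>X. (hier_walk N X n, X n))
        \<in> PiM UNIV (\<lambda>_. hier_step N r) \<rightarrow>\<^sub>M count_space ?C \<Otimes>\<^sub>M count_space ?C"
      by (intro measurable_Pair Suc X)
    from measurable_compose[OF this m] show ?case by simp
  qed
  note walk = this
  show ?thesis
  proof (rule measurable_PiM_single')
    show "(\<lambda>X. hier_walk N X n) \<in> PiM UNIV (\<lambda>_. hier_step N r) \<rightarrow>\<^sub>M count_space ?C" for n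
      by (rule walk)
    show "(\<lambda>X n. hier_walk N X n) \<in> space (PiM UNIV (\<lambda>_. hier_step N r))
        \<rightarrow> (\<Pi>\<^sub>E n\<in>UNIV. space (count_space ?C))"
      using measurable_space[OF walk] by (simp add: PiE_UNIV_domain)
  qed
qed

lemma prob_space_hier_walk_law:
  assumes "N \<ge> 2" and "\<And>j. r j \<ge> 0" and "(\<lambda>k. r (Suc k)) sums 1"
  shows "prob_space (hier_walk_law N r)"
  unfolding hier_walk_law_def
  by (intro prob_space.prob_space_distr prob_space_PiM prob_space_hier_step
      measurable_hier_walk assms)

end

theory Submission
  imports Defs "HOL-Real_Asymp.Real_Asymp"
begin

text \<open>
  The norm is an ultrametric, so the walk stays in the ball of radius \<open>j\<close> up to time \<open>n\<close> iff each of
  its first \<open>n\<close> steps lies in that ball. With \<open>q = \<eta> / N powr (1 / \<mu>)\<close> the norm of a step is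
  geometric, \<open>r\<^sub>k = (1 - q) q\<^sup>k\<^sup>-\<^sup>1\<close>, whence \<open>P (Z\<^sup>*\<^sub>n \<le> j) = (1 - q\<^sup>j)\<^sup>n\<close>. For \<open>n\<close> the
  integer part of \<open>N powr (j / \<mu>)\<close> we have \<open>n q\<^sup>j \<approx> \<eta>\<^sup>j\<close>, and both parts follow from
  \<open>(1 - x)\<^sup>n \<approx> exp (- n x)\<close>.
\<close>

subsection \<open>Limits of powers\<close>

text \<open>Both bounds come from \<open>1 + t <= exp t\<close>: taking t = -x gives the upper bound
  exp(-n x), and applying it to 1 / (1 - x) gives the lower bound exp(-n x / (1 - x)). Since x tends
  to 0, both exponents tend to -c.\<close>

lemma tendsto_one_minus_power:
  fixes x :: "'a \<Rightarrow> real" and n :: "'a \<Rightarrow> nat"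
  assumes x: "(x \<longlongrightarrow> 0) F" and nonneg: "\<forall>\<^sub>F i in F. 0 \<le> x i"
    and lim: "((\<lambda>i. real (n i) * x i) \<longlongrightarrow> c) F"
  shows "((\<lambda>i. (1 - x i) ^ n i) \<longlongrightarrow> exp (- c)) F"
proof (rule tendsto_sandwich)
  have lt: "\<forall>\<^sub>F i in F. x i < 1" using order_tendstoD(2)[OF x] by simp
  show "\<forall>\<^sub>F i in F. exp (- (real (n i) * x i / (1 - x i))) \<le> (1 - x i) ^ n i"
    using lt
  proof eventually_elim
    case (elim i)
    \<comment> \<open>Bounding the reciprocal from above turns the standard exponential inequality
      into a lower bound for 1 - x.\<close>
    have "1 / (1 - x i) = 1 + x i / (1 - x i)" using elim by (simp add: field_simps)
    also have "\<dots> \<le> exp (x i / (1 - x i))" by (rule exp_ge_add_one_self)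
    finally have "exp (- (x i / (1 - x i))) \<le> 1 - x i"
      using elim by (simp add: exp_minus field_simps)
    then have "exp (- (x i / (1 - x i))) ^ n i \<le> (1 - x i) ^ n i"
      by (intro power_mono) auto
    then show ?case by (simp add: exp_of_nat_mult[symmetric])
  qed
  show "\<forall>\<^sub>F i in F. (1 - x i) ^ n i \<le> exp (- (real (n i) * x i))"
    using lt
  proof eventually_elim
    case (elim i)
    have "(1 - x i) ^ n i \<le> exp (- x i) ^ n i"
      using elim exp_ge_add_one_self[of "- x i"] by (intro power_mono) auto
    then show ?case by (simp add: exp_of_nat_mult[symmetric])
  qed
  show "((\<lambda>i. exp (- (real (n i) * x i / (1 - x i)))) \<longlongrightarrow> exp (- c)) F"
    using tendsto_exp[OF tendsto_minus[OF tendsto_divide[OF lim tendsto_diff[OF tendsto_const[of 1] x]]]]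
    by simp
  show "((\<lambda>i. exp (- (real (n i) * x i))) \<longlongrightarrow> exp (- c)) F"
    by (intro tendsto_intros lim)
qed

text \<open>For an infinite rate the upper bound exp(-n x) suffices. Here x need not tend to 0; the
  condition x <= 1 keeps the base nonnegative and admits x = 1, which occurs below for balls of
  radius 0.\<close>

lemma tendsto_one_minus_power_0:
  fixes x :: "'a \<Rightarrow> real" and n :: "'a \<Rightarrow> nat"
  assumes le: "\<forall>\<^sub>F i in F. x i \<le> 1"
    and lim: "filterlim (\<lambda>i. real (n i) * x i) at_top F"
  shows "((\<lambda>i. (1 - x i) ^ n i) \<longlongrightarrow> 0) F"
proof (rule tendsto_sandwich[OF _ _ tendsto_const])
  show "\<forall>\<^sub>F i in F. 0 \<le> (1 - x i) ^ n i"
    using le by eventually_elim simp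
  show "\<forall>\<^sub>F i in F. (1 - x i) ^ n i \<le> exp (- (real (n i) * x i))"
    using le
  proof eventually_elim
    case (elim i)
    have "(1 - x i) ^ n i \<le> exp (- x i) ^ n i"
      using elim exp_ge_add_one_self[of "- x i"] by (intro power_mono) auto
    then show ?case by (simp add: exp_of_nat_mult[symmetric])
  qed
  show "((\<lambda>i. exp (- (real (n i) * x i))) \<longlongrightarrow> 0) F"
    by (rule filterlim_compose[OF exp_at_bot])
       (rule filterlim_compose[OF filterlim_uminus_at_bot_at_top lim])
qed

text \<open>Dividing f - 1 <= floor f <= f by f; this lets the integer number of steps be replaced
  by its real counterpart in the limits.\<close>

lemma tendsto_nat_floor_divide:
  fixes f :: "'a \<Rightarrow> real"
  assumes "filterlim f at_top F"
  shows "((\<lambda>i. real (nat \<lfloor>f i\<rfloor>) / f i) \<longlongrightarrow> 1) F"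
proof (rule tendsto_sandwich[OF _ _ _ tendsto_const])
  have pos: "\<forall>\<^sub>F i in F. f i > 0"
    using assms by (auto simp: filterlim_at_top_dense)
  show "\<forall>\<^sub>F i in F. 1 - 1 / f i \<le> real (nat \<lfloor>f i\<rfloor>) / f i"
    using pos
  proof eventually_elim
    case (elim i)
    have "f i - 1 \<le> real (nat \<lfloor>f i\<rfloor>)" by linarith
    then have "(f i - 1) / f i \<le> real (nat \<lfloor>f i\<rfloor>) / f i"
      using elim by (intro divide_right_mono) auto
    then show ?case using elim by (simp add: diff_divide_distrib)
  qed
  show "\<forall>\<^sub>F i in F. real (nat \<lfloor>f i\<rfloor>) / f i \<le> 1"
    using pos by eventually_elim (simp add: of_nat_floor)
  have "((\<lambda>i. 1 / f i) \<longlongrightarrow> 0) F"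
    by (intro tendsto_divide_0[OF tendsto_const] filterlim_at_top_imp_at_infinity assms)
  from tendsto_diff[OF tendsto_const[of 1] this]
  show "((\<lambda>i. 1 - 1 / f i) \<longlongrightarrow> 1) F" by simp
qed

subsection \<open>The walk in a ball\<close>

lemma one_closed_hier_group: "\<one>\<^bsub>hier_group N\<^esub> \<in> carrier (hier_group N)"
  by (rule monoid.one_closed[OF group.is_monoid[OF group_hier_group]])

text \<open>The ball of radius j is a subgroup: if x vanishes above j, then the sum agrees with y
  there. The equivalence, rather than mere closure, is what lets a condition on positions be read
  back as one on steps.\<close>

lemma hier_norm_mult_le_iff:
  assumes N: "N \<ge> 2" and x: "x \<in> carrier (hier_group N)" and y: "y \<in> carrier (hier_group N)"
    and xj: "hier_norm x \<le> j"
  shows "hier_norm (x \<otimes>\<^bsub>hier_group N\<^esub> y) \<le> j \<longleftrightarrow> hier_norm y \<le> j"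
proof -
  have xy: "x \<otimes>\<^bsub>hier_group N\<^esub> y \<in> carrier (hier_group N)"
    by (rule monoid.m_closed[OF group.is_monoid[OF group_hier_group] x y])
  have "(x \<otimes>\<^bsub>hier_group N\<^esub> y) i = 0 \<longleftrightarrow> y i = 0" if i: "i > j" for i
  proof -
    have "x i = 0" using xj i by (simp add: hier_norm_le_iff[OF N x])
    then have "(x \<otimes>\<^bsub>hier_group N\<^esub> y) i = y i mod int N"
      using i N by (simp add: hier_group_def integer_mod_group_def)
    \<comment> \<open>Coordinates of carrier elements are reduced representatives in
      \<open>{0..<int N}\<close>.\<close>
    also have "y i mod int N = y i"
      using i y N by (simp add: carrier_hier_group PiE_iff Ball_def)
    finally show ?thesis by simp
  qed
  then show ?thesis by (simp add: hier_norm_le_iff[OF N xy] hier_norm_le_iff[OF N y])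
qed

lemma hier_walk_in_carrier:
  assumes "\<And>m. X m \<in> carrier (hier_group N)"
  shows "hier_walk N X n \<in> carrier (hier_group N)"
  by (induction n)
     (simp_all add: one_closed_hier_group assms
        monoid.m_closed[OF group.is_monoid[OF group_hier_group]])

text \<open>Induction on n: from a position in the ball, the next position lies in the ball exactly
  when the step does. All times up to n are needed on the left, since a walk that has left the ball
  may come back.\<close>

lemma hier_walk_norm_le_iff:
  assumes N: "N \<ge> 2" and X: "\<And>m. X m \<in> carrier (hier_group N)"
  shows "(\<forall>m\<le>n. hier_norm (hier_walk N X m) \<le> j) \<longleftrightarrow> (\<forall>m<n. hier_norm (X m) \<le> j)"
proof (induction n)
  case 0
  then show ?case
    using hier_norm_eq_0_iff[OF N one_closed_hier_group] by simp
next
  case (Suc n)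
  have "hier_norm (hier_walk N X n) \<le> j \<Longrightarrow>
      hier_norm (hier_walk N X (Suc n)) \<le> j \<longleftrightarrow> hier_norm (X n) \<le> j"
    using hier_norm_mult_le_iff[OF N hier_walk_in_carrier[OF X] X] by simp
  then show ?case
    using Suc by (auto simp: le_Suc_eq less_Suc_eq simp del: hier_walk.simps)
qed

lemma max_norm_hier_walk_le_iff:
  assumes N: "N \<ge> 2" and X: "\<And>m. X m \<in> carrier (hier_group N)" and n: "n \<ge> 1"
  shows "max_norm (hier_walk N X) n \<le> j \<longleftrightarrow> (\<forall>m<n. hier_norm (X m) \<le> j)"
proof -
  have "max_norm (hier_walk N X) n \<le> j \<longleftrightarrow> (\<forall>m\<in>{1..n}. hier_norm (hier_walk N X m) \<le> j)"
    unfolding max_norm_def using n by (subst Max_le_iff) auto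
  \<comment> \<open>The running maximum starts at time 1, but including time 0 changes nothing
    because the starting point has norm 0.\<close>
  also have "\<dots> \<longleftrightarrow> (\<forall>m\<le>n. hier_norm (hier_walk N X m) \<le> j)"
  proof -
    have "hier_norm (hier_walk N X 0) \<le> j"
      using hier_norm_eq_0_iff[OF N one_closed_hier_group] by simp
    then show ?thesis by (metis One_nat_def Suc_leI atLeastAtMost_iff bot_nat_0.not_eq_extremum)
  qed
  finally show ?thesis unfolding hier_walk_norm_le_iff[OF N X] .
qed

subsection \<open>The distribution of the running maximum\<close>

text \<open>The mass \<open>r (Suc k)\<close> is spread evenly over the N^k (N - 1) points of the
  sphere of radius k + 1. Induction on j adds one sphere at a time, starting from the radius-0 ball,
  which is the massless identity.\<close>

lemma measure_hier_step_ball: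
  assumes N: "N \<ge> 2" and r: "\<And>j. r j \<ge> 0"
  shows "measure (hier_step N r) {x \<in> carrier (hier_group N). hier_norm x \<le> j} = (\<Sum>k<j. r (Suc k))"
proof -
  let ?B = "{x \<in> carrier (hier_group N). hier_norm x \<le> j}"
  have nonneg: "hier_step_prob N r y \<ge> 0" for y
    using N r by (simp add: hier_step_prob_def)
  have "emeasure (hier_step N r) ?B = (\<Sum>y\<in>?B. ennreal (hier_step_prob N r y))"
    unfolding hier_step_def using card_hier_ball(1)[OF N]
    by (subst emeasure_point_measure_finite2) auto
  also have "\<dots> = ennreal (\<Sum>y\<in>?B. hier_step_prob N r y)"
    by (rule sum_ennreal) (rule nonneg)
  finally have "measure (hier_step N r) ?B = (\<Sum>y\<in>?B. hier_step_prob N r y)"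
    by (simp add: measure_def sum_nonneg nonneg)
  also have "\<dots> = (\<Sum>k<j. r (Suc k))"
  proof (induction j)
    case 0
    have "hier_step_prob N r y = 0" if "y \<in> carrier (hier_group N)" "hier_norm y \<le> 0" for y
      using hier_norm_eq_0_iff[OF N that(1)] that(2) by (simp add: hier_step_prob_def)
    then show ?case by (simp add: sum.neutral)
  next
    case (Suc j)
    let ?B = "{x \<in> carrier (hier_group N). hier_norm x \<le> j}"
    let ?S = "{x \<in> carrier (hier_group N). hier_norm x = Suc j}"
    have eq: "{x \<in> carrier (hier_group N). hier_norm x \<le> Suc j} = ?B \<union> ?S" by auto
    have "(\<Sum>y\<in>?S. hier_step_prob N r y) = (\<Sum>y\<in>?S. r (Suc j) / (real N ^ j * (real N - 1)))"
    proof (rule sum.cong[OF refl])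
      fix y assume y: "y \<in> ?S"
      then have "y \<noteq> \<one>\<^bsub>hier_group N\<^esub>"
        using hier_norm_eq_0_iff[OF N, of y] by fastforce
      then show "hier_step_prob N r y = r (Suc j) / (real N ^ j * (real N - 1))"
        using y by (simp add: hier_step_prob_def)
    qed
    also have "\<dots> = r (Suc j)"
      using N by (simp add: card_hier_sphere(2)[OF N])
    finally have "(\<Sum>y\<in>?S. hier_step_prob N r y) = r (Suc j)" .
    then show ?case
      unfolding eq using card_hier_ball(1)[OF N] card_hier_sphere(1)[OF N] Suc
      by (subst sum.union_disjoint) auto
  qed
  finally show ?thesis .
qed

lemma max_norm_le_event:
  assumes N: "N \<ge> 2" and n: "n \<ge> 1"
  shows "{\<xi> \<in> space (hier_walk_law N r). max_norm \<xi> n \<le> j} \<in> sets (hier_walk_law N r)"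
proof -
  let ?C = "carrier (hier_group N)"
  have [measurable]: "hier_norm \<in> count_space ?C \<rightarrow>\<^sub>M count_space UNIV"
    by simp
  have "{\<xi> \<in> space (PiM UNIV (\<lambda>_. count_space ?C)). max_norm \<xi> n \<le> j}
      = {\<xi> \<in> space (PiM UNIV (\<lambda>_. count_space ?C)). \<forall>m\<in>{1..n}. hier_norm (\<xi> m) \<le> j}"
    unfolding max_norm_def using n by (subst Max_le_iff) auto
  also have "\<dots> \<in> sets (PiM UNIV (\<lambda>_. count_space ?C))"
    by measurable
  finally show ?thesis by (simp add: hier_walk_law_def)
qed

text \<open>Pulled back to the space of steps, the event is a cylinder: each of the first n steps
  lies in the ball and the later ones are free. Independence then gives the n-th power of the mass
  of the ball.\<close>

lemma measure_max_norm_le: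
  assumes N: "N \<ge> 2" and r: "\<And>j. r j \<ge> 0" "(\<lambda>k. r (Suc k)) sums 1" and n: "n \<ge> 1"
  shows "measure (hier_walk_law N r) {\<xi> \<in> space (hier_walk_law N r). max_norm \<xi> n \<le> j}
      = (\<Sum>k<j. r (Suc k)) ^ n"
proof -
  let ?C = "carrier (hier_group N)" and ?P = "PiM UNIV (\<lambda>_::nat. hier_step N r)"
  let ?B = "{x \<in> ?C. hier_norm x \<le> j}"
  interpret P: product_prob_space "\<lambda>_. hier_step N r" "UNIV :: nat set"
    by (intro product_prob_spaceI prob_space_hier_step assms)
  have sp: "space (hier_step N r) = ?C"
    by (simp add: hier_step_def space_point_measure)
  have in_space: "X \<in> space ?P \<longleftrightarrow> (\<forall>m. X m \<in> ?C)" for X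
    by (simp add: space_PiM sp PiE_iff)
  have "measure (hier_walk_law N r) {\<xi> \<in> space (hier_walk_law N r). max_norm \<xi> n \<le> j}
      = measure ?P (hier_walk N -` {\<xi> \<in> space (hier_walk_law N r). max_norm \<xi> n \<le> j} \<inter> space ?P)"
    using max_norm_le_event[OF N n, of r j] unfolding hier_walk_law_def
    by (subst measure_distr[OF measurable_hier_walk[OF N]]) auto
  also have "hier_walk N -` {\<xi> \<in> space (hier_walk_law N r). max_norm \<xi> n \<le> j} \<inter> space ?P
      = {X \<in> space ?P. \<forall>m<n. hier_norm (X m) \<le> j}"
    by (rule Set.set_eqI)
       (use hier_walk_in_carrier max_norm_hier_walk_le_iff[OF N _ n] in
         \<open>auto simp: in_space hier_walk_law_def space_PiM PiE_iff sp\<close>)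
  also have "\<dots> = prod_emb UNIV (\<lambda>_. hier_step N r) {..<n} (\<Pi>\<^sub>E m\<in>{..<n}. ?B)"
    by (auto simp: prod_emb_def in_space PiE_iff space_PiM sp)
  also have "measure ?P \<dots> = (\<Prod>m<n. measure (hier_step N r) ?B)"
    by (rule P.measure_PiM_emb) (auto simp: hier_step_def sets_point_measure)
  also have "\<dots> = (\<Sum>k<j. r (Suc k)) ^ n"
    by (simp add: measure_hier_step_ball[OF N r(1)])
  finally show ?thesis .
qed

text \<open>The weights are exactly the powers of q, so the normalizing constant is 1 - q and the
  norm of a step is geometrically distributed.\<close>

lemma eta_rate_Suc:
  assumes "\<mu> \<ge> 1" "\<eta> > 0" "N \<ge> 2" "real N powr (1 / \<mu>) > \<eta>"
  defines "q \<equiv> \<eta> / real N powr (1 / \<mu>)"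
  shows "eta_rate \<mu> \<eta> N (Suc k) = (1 - q) * q ^ k"
proof -
  have q: "0 < q" "q < 1" using assms by (auto simp: q_def)
  have w: "eta_weight \<mu> \<eta> N (Suc k) = q ^ k" for k
    using assms(3) by (simp add: eta_weight_def q_def power_divide powr_power powr_minus_divide)
  have "(\<lambda>k. q ^ k) sums (1 / (1 - q))" using q by (intro geometric_sums) auto
  then show ?thesis by (simp add: eta_rate_def w sums_iff)
qed

lemma eta_walk_prob_max_norm_le:
  assumes "\<mu> \<ge> 1" "\<eta> > 0" "N \<ge> 2" "real N powr (1 / \<mu>) > \<eta>" "n \<ge> 1"
  shows "eta_walk_prob \<mu> \<eta> N (\<lambda>\<xi>. max_norm \<xi> n \<le> j) = (1 - (\<eta> / real N powr (1 / \<mu>)) ^ j) ^ n"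
proof -
  note r = eta_rate_sums[OF assms(1-4)]
  define q where "q = \<eta> / real N powr (1 / \<mu>)"
  have "(\<Sum>k<j. eta_rate \<mu> \<eta> N (Suc k)) = 1 - q ^ j"
    unfolding eta_rate_Suc[OF assms(1-4)] q_def[symmetric] sum_distrib_left[symmetric]
    by (rule one_diff_power_eq[symmetric])
  then show ?thesis
    unfolding eta_walk_prob_def
    using measure_max_norm_le[OF assms(3) less_imp_le[OF r(1)] r(2) assms(5)] by (simp add: q_def)
qed

text \<open>Point probabilities are differences of distribution-function values, which reduces the
  second limit to events of the form \<open>max_norm \<xi> n \<le> l\<close>.\<close>

lemma eta_walk_prob_max_norm_eq_Suc:
  assumes "\<mu> \<ge> 1" "\<eta> > 0" "N \<ge> 2" "real N powr (1 / \<mu>) > \<eta>" "n \<ge> 1"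
  shows "eta_walk_prob \<mu> \<eta> N (\<lambda>\<xi>. max_norm \<xi> n = Suc l)
      = eta_walk_prob \<mu> \<eta> N (\<lambda>\<xi>. max_norm \<xi> n \<le> Suc l)
        - eta_walk_prob \<mu> \<eta> N (\<lambda>\<xi>. max_norm \<xi> n \<le> l)"
proof -
  let ?M = "hier_walk_law N (eta_rate \<mu> \<eta> N)"
  note r = eta_rate_sums[OF assms(1-4)]
  interpret prob_space ?M
    by (rule prob_space_hier_walk_law[OF assms(3) less_imp_le[OF r(1)] r(2)])
  have eq: "{\<xi> \<in> space ?M. max_norm \<xi> n = Suc l}
      = {\<xi> \<in> space ?M. max_norm \<xi> n \<le> Suc l} - {\<xi> \<in> space ?M. max_norm \<xi> n \<le> l}"
    by auto
  show ?thesis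
    unfolding eta_walk_prob_def eq
    by (rule finite_measure_Diff) (auto intro!: max_norm_le_event assms)
qed

lemma powr_scale:
  assumes "N \<ge> 2"
  shows "real N powr (real j / \<mu>) = (real N powr (1 / \<mu>)) ^ j"
  using assms by (simp add: powr_power)

subsection \<open>The two limits\<close>

text \<open>With a = N^(1/\<mu>), the rate n (\<eta>/a)^j is \<eta>^j times a factor tending to 1.
  Hence it diverges, tends to 1 or vanishes according to the position of \<eta> relative to
  1.\<close>

lemma fixed_N_limit:
  assumes "\<mu> \<ge> 1" "\<eta> > 0" "N \<ge> 2" "real N powr (1 / \<mu>) > \<eta>"
  shows "(\<lambda>j. eta_walk_prob \<mu> \<eta> N (\<lambda>\<xi>. max_norm \<xi> (nat \<lfloor>real N powr (real j / \<mu>)\<rfloor>) \<le> j))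
           \<longlonglongrightarrow> (if \<eta> > 1 then 0 else if \<eta> = 1 then 1 / exp 1 else 1)"
proof -
  define a where "a = real N powr (1 / \<mu>)"
  define n where "n j = nat \<lfloor>a ^ j\<rfloor>" for j
  have a: "a > 1" "a > \<eta>" using assms by (auto simp: a_def)
  have n1: "n j \<ge> 1" for j
  proof -
    have "a ^ j \<ge> 1" using a by simp
    then show ?thesis by (simp add: n_def le_nat_iff)
  qed
  have ratio: "(\<lambda>j. real (n j) / a ^ j) \<longlonglongrightarrow> 1"
    unfolding n_def
    by (intro tendsto_nat_floor_divide) (use a in real_asymp)
  have nx: "real (n j) * (\<eta> / a) ^ j = real (n j) / a ^ j * \<eta> ^ j" for j
    by (simp add: power_divide)
  have x: "(\<lambda>j. (\<eta> / a) ^ j) \<longlonglongrightarrow> 0"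
    using a assms(2) by (intro LIMSEQ_power_zero) simp
  have "(\<lambda>j. (1 - (\<eta> / a) ^ j) ^ n j)
      \<longlonglongrightarrow> (if \<eta> > 1 then 0 else if \<eta> = 1 then 1 / exp 1 else 1)"
  proof -
    consider "\<eta> > 1" | "\<eta> = 1" | "\<eta> < 1" by linarith
    then show ?thesis
    proof cases
      case 1
      have "filterlim (\<lambda>j. real (n j) * (\<eta> / a) ^ j) at_top sequentially"
        unfolding nx
        by (rule filterlim_tendsto_pos_mult_at_top[OF ratio]) (use 1 in \<open>simp, real_asymp\<close>)
      moreover have "(\<eta> / a) ^ j \<le> 1" for j
        using a assms(2) by (intro power_le_one) auto
      ultimately show ?thesis using 1 by (simp add: tendsto_one_minus_power_0)
    next
      case 2
      have "(\<lambda>j. real (n j) * (\<eta> / a) ^ j) \<longlonglongrightarrow> 1"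
        unfolding nx using ratio 2 by simp
      from tendsto_one_minus_power[OF x _ this] show ?thesis
        using 2 a by (simp add: exp_minus inverse_eq_divide)
    next
      case 3
      have "(\<lambda>j. \<eta> ^ j) \<longlonglongrightarrow> 0"
        using 3 assms(2) by (intro LIMSEQ_power_zero) simp
      then have "(\<lambda>j. real (n j) * (\<eta> / a) ^ j) \<longlonglongrightarrow> 0"
        unfolding nx using tendsto_mult[OF ratio] by fastforce
      from tendsto_one_minus_power[OF x _ this] show ?thesis
        using 3 a assms(2) by simp
    qed
  qed
  moreover have "eta_walk_prob \<mu> \<eta> N (\<lambda>\<xi>. max_norm \<xi> (nat \<lfloor>real N powr (real j / \<mu>)\<rfloor>) \<le> j)
      = (1 - (\<eta> / a) ^ j) ^ n j" for j
    using eta_walk_prob_max_norm_le[OF assms n1[of j], of j]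
    unfolding powr_scale[OF assms(3)] by (simp add: n_def a_def)
  ultimately show ?thesis by presburger
qed

text \<open>With n close to a^j, the rate n (\<eta>/a)^l behaves like \<eta>^l a^(j - l). As a
  grows, it diverges for l = j - 1, tends to \<eta>^j for l = j and vanishes for l = j + 1, which
  yields the three limits.\<close>

lemma large_N_limit:
  assumes "\<mu> \<ge> 1" "\<eta> > 0" "j \<ge> 1"
  defines "p \<equiv> \<lambda>j l N. eta_walk_prob \<mu> \<eta> N
                  (\<lambda>\<xi>. max_norm \<xi> (nat \<lfloor>real N powr (real j / \<mu>)\<rfloor>) \<le> l)"
  shows "p j (j - 1) \<longlonglongrightarrow> 0" "p j j \<longlonglongrightarrow> exp (- (\<eta> ^ j))" "p j (Suc j) \<longlonglongrightarrow> 1"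
    and "\<forall>\<^sub>F N in sequentially. eta_walk_prob \<mu> \<eta> N
           (\<lambda>\<xi>. max_norm \<xi> (nat \<lfloor>real N powr (real j / \<mu>)\<rfloor>) = Suc l) = p j (Suc l) N - p j l N"
proof -
  define a where "a N = real N powr (1 / \<mu>)" for N
  define n where "n j N = nat \<lfloor>a N ^ j\<rfloor>" for j N
  have a: "filterlim a at_top sequentially"
    unfolding a_def using assms(1)
    by real_asymp
  \<comment> \<open>The exact formulas hold for admissible N only: a > \<eta> makes the weights
    summable, and a >= 1 guarantees at least one step, so that the maximum is over a nonempty
    set.\<close>
  have ev: "\<forall>\<^sub>F N in sequentially. N \<ge> 2 \<and> a N > \<eta> \<and> a N \<ge> 1"
    using eventually_ge_at_top[of 2] filterlim_at_top_dense[THEN iffD1, OF a, rule_format, of \<eta>]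
      filterlim_at_top[THEN iffD1, OF a, rule_format, of 1]
    by eventually_elim simp
  have n1: "nat \<lfloor>real N powr (real j / \<mu>)\<rfloor> = n j N" "n j N \<ge> 1" if "N \<ge> 2" "a N \<ge> 1" for j N
  proof -
    show "nat \<lfloor>real N powr (real j / \<mu>)\<rfloor> = n j N"
      unfolding powr_scale[OF that(1)] n_def a_def ..
    have "a N ^ j \<ge> 1" using that by simp
    then show "n j N \<ge> 1" by (simp add: n_def le_nat_iff)
  qed
  have peq: "\<forall>\<^sub>F N in sequentially. (1 - (\<eta> / a N) ^ l) ^ n j N = p j l N" for j l
    using ev
  proof eventually_elim
    case (elim N)
    then show ?case
      using eta_walk_prob_max_norm_le[OF assms(1,2), of N "n j N" l] n1[of N j]
      by (simp add: p_def a_def)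
  qed
  have ratio: "(\<lambda>N. real (n j N) / a N ^ j) \<longlonglongrightarrow> 1" for j
  \<comment> \<open>The bound j is universally quantified here. For exponent 0 the power does not
    diverge, but the quotient is constantly 1.\<close>
  proof (cases "j = 0")
    case False
    then show ?thesis
      unfolding n_def by (intro tendsto_nat_floor_divide filterlim_pow_at_top a) simp
  qed (simp add: n_def)
  have q: "(\<lambda>N. \<eta> / a N) \<longlonglongrightarrow> 0"
    by (intro tendsto_divide_0[OF tendsto_const] filterlim_at_top_imp_at_infinity a)
  have q0: "\<forall>\<^sub>F N in sequentially. 0 \<le> (\<eta> / a N) ^ l" for l
    using ev by eventually_elim (use assms(2) in simp)
  have nx: "(\<lambda>N. real (n j N) * (\<eta> / a N) ^ j) \<longlonglongrightarrow> \<eta> ^ j" for j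
    using tendsto_mult_right[OF ratio[of j], of "\<eta> ^ j"] by (simp add: power_divide)
  show "p j (j - 1) \<longlonglongrightarrow> 0"
  proof (rule Lim_transform_eventually[OF tendsto_one_minus_power_0 peq])
    \<comment> \<open>For j = 1 this power is identically 1, so the criterion for a vanishing base
      cannot be used.\<close>
    show "\<forall>\<^sub>F N in sequentially. (\<eta> / a N) ^ (j - 1) \<le> 1"
      using ev by eventually_elim (use assms(2) in \<open>auto intro!: power_le_one\<close>)
    \<comment> \<open>The rate is rewritten to isolate the one surplus factor a: the rest converges
      to the positive constant \<eta>^(j - 1).\<close>
    have "filterlim (\<lambda>N. real (n j N) / a N ^ j * \<eta> ^ (j - 1) * a N) at_top sequentially"
      using assms(2) tendsto_mult_right[OF ratio[of j], of "\<eta> ^ (j - 1)"]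
      by (intro filterlim_tendsto_pos_mult_at_top[where c = "\<eta> ^ (j - 1)", OF _ _ a]) auto
    moreover have "\<forall>\<^sub>F N in sequentially. real (n j N) / a N ^ j * \<eta> ^ (j - 1) * a N
        = real (n j N) * (\<eta> / a N) ^ (j - 1)"
      using ev
    proof eventually_elim
      case (elim N)
      have "a N ^ j = a N * a N ^ (j - 1)" using assms(3) by (simp add: power_eq_if)
      then show ?case using elim assms(2) by (simp add: power_divide field_simps)
    qed
    ultimately show "filterlim (\<lambda>N. real (n j N) * (\<eta> / a N) ^ (j - 1)) at_top sequentially"
      using filterlim_cong[OF refl refl] by fastforce
  qed
  show "p j j \<longlonglongrightarrow> exp (- (\<eta> ^ j))"
  proof -
    have "(\<lambda>N. (\<eta> / a N) ^ j) \<longlonglongrightarrow> 0" using q assms(3) by simp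
    from Lim_transform_eventually[OF tendsto_one_minus_power[OF this q0 nx] peq]
    show ?thesis .
  qed
  show "p j (Suc j) \<longlonglongrightarrow> 1"
  proof (rule Lim_transform_eventually[OF _ peq])
    have "(\<lambda>N. (\<eta> / a N) ^ Suc j) \<longlonglongrightarrow> 0" using tendsto_power[OF q, of "Suc j"] by simp
    moreover have "(\<lambda>N. real (n j N) * (\<eta> / a N) ^ Suc j) \<longlonglongrightarrow> 0"
      using tendsto_mult[OF nx[of j] q] by (simp add: mult_ac)
    ultimately show "(\<lambda>N. (1 - (\<eta> / a N) ^ Suc j) ^ n j N) \<longlonglongrightarrow> 1"
      using tendsto_one_minus_power[OF _ q0] by fastforce
  qed
  show "\<forall>\<^sub>F N in sequentially. eta_walk_prob \<mu> \<eta> N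
      (\<lambda>\<xi>. max_norm \<xi> (nat \<lfloor>real N powr (real j / \<mu>)\<rfloor>) = Suc l) = p j (Suc l) N - p j l N"
    using ev
  proof eventually_elim
    case (elim N)
    then show ?case
      using eta_walk_prob_max_norm_eq_Suc[OF assms(1,2), of N "n j N" l] n1[of N j]
      by (simp add: p_def a_def)
  qed
qed

theorem corollary3p5p10:
  fixes \<mu> \<eta> :: real
  assumes "\<mu> \<ge> 1" and "\<eta> > 0"
  shows "(\<forall>N\<ge>2. real N powr (1 / \<mu>) > \<eta> \<longrightarrow>
            (let p = (\<lambda>j. eta_walk_prob \<mu> \<eta> N
                         (\<lambda>\<xi>. max_norm \<xi> (nat \<lfloor>real N powr (real j / \<mu>)\<rfloor>) \<le> j))
             in (p \<longlonglongrightarrow> 0 \<longleftrightarrow> \<eta> > 1) \<and>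
                (p \<longlonglongrightarrow> 1 / exp 1 \<longleftrightarrow> \<eta> = 1) \<and>
                (p \<longlonglongrightarrow> 1 \<longleftrightarrow> \<eta> < 1))) \<and>
         (\<forall>j\<ge>1. let q = (\<lambda>l N. eta_walk_prob \<mu> \<eta> N
                         (\<lambda>\<xi>. max_norm \<xi> (nat \<lfloor>real N powr (real j / \<mu>)\<rfloor>) = l))
             in (q j \<longlonglongrightarrow> exp (- (\<eta> ^ j))) \<and>
                (q (j + 1) \<longlonglongrightarrow> 1 - exp (- (\<eta> ^ j))))"
proof (intro conjI allI impI)
  fix N :: nat assume N: "N \<ge> 2" "real N powr (1 / \<mu>) > \<eta>"
  note lim = fixed_N_limit[OF assms N]
  \<comment> \<open>The three candidate limits are pairwise distinct, so uniqueness of limits turns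
    the case distinction on \<eta> into three equivalences.\<close>
  have ne: "1 / exp (1::real) \<noteq> 0" "1 / exp (1::real) \<noteq> 1" by auto
  show "let p = (\<lambda>j. eta_walk_prob \<mu> \<eta> N
                  (\<lambda>\<xi>. max_norm \<xi> (nat \<lfloor>real N powr (real j / \<mu>)\<rfloor>) \<le> j))
        in (p \<longlonglongrightarrow> 0 \<longleftrightarrow> \<eta> > 1) \<and> (p \<longlonglongrightarrow> 1 / exp 1 \<longleftrightarrow> \<eta> = 1) \<and> (p \<longlonglongrightarrow> 1 \<longleftrightarrow> \<eta> < 1)"
    unfolding Let_def using lim LIMSEQ_unique[OF lim] ne
    by (smt (verit, best))
next
  fix j :: nat assume j: "j \<ge> 1"
  note lim = large_N_limit[OF assms j]
  have "Suc (j - 1) = j" using j by simp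
  note eq = lim(4)[of "j - 1", unfolded this] lim(4)[of j]
  show "let q = (\<lambda>l N. eta_walk_prob \<mu> \<eta> N
                  (\<lambda>\<xi>. max_norm \<xi> (nat \<lfloor>real N powr (real j / \<mu>)\<rfloor>) = l))
        in q j \<longlonglongrightarrow> exp (- (\<eta> ^ j)) \<and> q (j + 1) \<longlonglongrightarrow> 1 - exp (- (\<eta> ^ j))"
    unfolding Let_def Suc_eq_plus1[symmetric] tendsto_cong[OF eq(1)] tendsto_cong[OF eq(2)]
    \<comment> \<open>The limits at radii j - 1, j and j + 1 are 0, exp(-\<eta>^j) and 1;
      consecutive differences give the two point masses.\<close>
    using tendsto_diff[OF lim(2) lim(1)] tendsto_diff[OF lim(3) lim(2)] by simp
qed

end
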